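(* Let $n$ be an even positive integer, $m$ a positive integer, $a,b$ non-negative integers with $a+b=n$, and $x,y$ complex numbers with $ax+by=0$. Define \[ R_{1,2}(x,y;m,n;\tau)= mn\, i^{a}q^{-\frac{n}{4}}\sum_{\substack{r_1,\ldots,r_a,s_1,\ldots,s_b\in\mathbb{Z}\\ 2(r_1+\cdots+r_a+s_1+\cdots+s_b)+n=0}}(-1)^{r_1+\cdots+r_a}q^{r_1^2+\cdots+r_a^2+s_1^2+\cdots+s_b^2}e^{2i((r_1+\cdots+r_a)x+(s_1+\cdots+s_b)y)}. \] Let $S(z)=\sum_{k=0}^{mn-1}\vartheta_1^{a}\!\left(z+x+\tfrac{k\pi}{mn}\Big|\tau\right)\vartheta_2^{b}\!\left(z+y+\tfrac{k\pi}{mn}\Big|\tau\right)$. Then for all $z\in\mathbb{C}$: if $ma$ is even, $S(z)=R_{1,2}(x,y;m,n;\tau)\,\vartheta_3(mnz\,|\,m^2n\tau)$; if $ma$ is odd, $S(z)=R_{1,2}(x,y;m,n;\tau)\,\vartheta_4(mnz\,|\,m^2n\tau)$.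
   Context: Throughout, $\tau\in\mathbb{C}$ with $\Im(\tau)>0$, $q=e^{\pi i\tau}$, and $q^{\alpha}$ means $e^{\pi i\alpha\tau}$ for real $\alpha$. The Jacobi theta functions are $\vartheta_1(z|\tau)=-iq^{1/4}\sum_{n\in\mathbb{Z}}(-1)^nq^{n(n+1)}e^{(2n+1)iz}$, $\vartheta_2(z|\tau)=q^{1/4}\sum_{n\in\mathbb{Z}}q^{n(n+1)}e^{(2n+1)iz}$, $\vartheta_3(z|\tau)=\sum_{n\in\mathbb{Z}}q^{n^2}e^{2niz}$, $\vartheta_4(z|\tau)=\sum_{n\in\mathbb{Z}}(-1)^nq^{n^2}e^{2niz}$; and $\vartheta_j(z|m^2n\tau)$ denotes the same function with $\tau$ replaced by $m^2n\tau$. A zeroth power equals $1$.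
   Formalization: The constant i^a in R_{1,2} is replaced by (-i)^a; the printed sign is wrong for odd a (e.g. n=2, m=a=b=1, y=-x gives S ~ 4q^{1/2} sin 2x but printed R ~ -4q^{1/2} sin 2x), and the two agree for even a. *)

theory Defs
  imports "HOL-Analysis.Analysis"
begin

text \<open>\<open>nome_pow \<tau> \<alpha>\<close> is $q^\alpha$ for the nome $q = e^{\pi i \tau}$; it is defined through
  \<open>\<tau>\<close>, since a complex power of $q$ would depend on the branch of the logarithm.\<close>

definition nome_pow :: "complex \<Rightarrow> real \<Rightarrow> complex" where
  "nome_pow \<tau> \<alpha> = exp (of_real pi * \<i> * of_real \<alpha> * \<tau>)"

definition theta1 :: "complex \<Rightarrow> complex \<Rightarrow> complex" where
  "theta1 z \<tau> = - \<i> * nome_pow \<tau> (1/4) *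
     (\<Sum>\<^sub>\<infinity>n::int. (-1) powi n * nome_pow \<tau> (of_int (n * (n + 1))) * exp (of_int (2 * n + 1) * \<i> * z))"

definition theta2 :: "complex \<Rightarrow> complex \<Rightarrow> complex" where
  "theta2 z \<tau> = nome_pow \<tau> (1/4) *
     (\<Sum>\<^sub>\<infinity>n::int. nome_pow \<tau> (of_int (n * (n + 1))) * exp (of_int (2 * n + 1) * \<i> * z))"

definition theta3 :: "complex \<Rightarrow> complex \<Rightarrow> complex" where
  "theta3 z \<tau> = (\<Sum>\<^sub>\<infinity>n::int. nome_pow \<tau> (of_int (n\<^sup>2)) * exp (2 * of_int n * \<i> * z))"

definition theta4 :: "complex \<Rightarrow> complex \<Rightarrow> complex" where
  "theta4 z \<tau> = (\<Sum>\<^sub>\<infinity>n::int. (-1) powi n * nome_pow \<tau> (of_int (n\<^sup>2)) * exp (2 * of_int n * \<i> * z))"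

definition R12_indices :: "nat \<Rightarrow> nat \<Rightarrow> nat \<Rightarrow> ((nat \<Rightarrow> int) \<times> (nat \<Rightarrow> int)) set" where
  "R12_indices a b n =
     {(r, s). r \<in> {1..a} \<rightarrow>\<^sub>E UNIV \<and> s \<in> {1..b} \<rightarrow>\<^sub>E UNIV \<and>
              2 * ((\<Sum>j=1..a. r j) + (\<Sum>j=1..b. s j)) + int n = 0}"

text \<open>The constant is $(-i)^a$, one factor $-i$ from each \<open>theta1\<close>. The source prints $i^a$, which
  has the wrong sign for odd $a$: for $n = 2$, $m = a = b = 1$, $y = -x$ the leading term of
  $\vartheta_1(z+x)\vartheta_2(z-x) + \vartheta_1(z+x+\pi/2)\vartheta_2(z-x+\pi/2)$ as $q \to 0$
  is $4 q^{1/2} \sin 2x$, whereas $i^a$ would give $-4 q^{1/2} \sin 2x$.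
  For even $a$ the two constants agree.\<close>

definition R12 :: "nat \<Rightarrow> nat \<Rightarrow> complex \<Rightarrow> complex \<Rightarrow> nat \<Rightarrow> nat \<Rightarrow> complex \<Rightarrow> complex" where
  "R12 a b x y m n \<tau> =
     of_nat (m * n) * (- \<i>) ^ a * nome_pow \<tau> (- (real n / 4)) *
     (\<Sum>\<^sub>\<infinity>(r, s) \<in> R12_indices a b n.
        (-1) powi (\<Sum>j=1..a. r j) *
        nome_pow \<tau> (of_int ((\<Sum>j=1..a. (r j)\<^sup>2) + (\<Sum>j=1..b. (s j)\<^sup>2))) *
        exp (2 * \<i> * (of_int (\<Sum>j=1..a. r j) * x + of_int (\<Sum>j=1..b. s j) * y)))"

definition theta_sum :: "nat \<Rightarrow> nat \<Rightarrow> complex \<Rightarrow> complex \<Rightarrow> nat \<Rightarrow> nat \<Rightarrow> complex \<Rightarrow> complex \<Rightarrow> complex" where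
  "theta_sum a b x y m n \<tau> z =
     (\<Sum>k<m * n. theta1 (z + x + of_real (real k * pi / real (m * n))) \<tau> ^ a *
                theta2 (z + y + of_real (real k * pi / real (m * n))) \<tau> ^ b)"

end

theory Submission
  imports Defs
begin

text \<open>Expand the product of powers into one absolutely convergent series over integer vectors
  $(r, s)$. Its dependence on the translation $k\pi/(mn)$ is through $e^{i(2N+n)k\pi/(mn)}$, where
  $N$ is the sum of all indices, so summing over $k$ keeps exactly the vectors with
  $mn \mid N + n/2$ (here $n$ is even). Writing $N + n/2 = mnl$ and subtracting $ml$ from every
  index gives a bijection with the pairs of an integer $l$ and a vector with $2N + n = 0$. Since
  $ax + by = 0$, the summand factors into the $l$-th term of a theta series at $m^2n\tau$, with
  sign $(-1)^{mal}$, times a summand of \<open>R12\<close>.\<close>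

no_notation Infinite_Set_Sum.abs_summable_on (infix "abs'_summable'_on" 50)

section \<open>Absolutely summable products\<close>

lemma abs_summable_on_times:
  fixes f :: "'a \<Rightarrow> 'c::{real_normed_field,banach}" and g :: "'b \<Rightarrow> 'c"
  assumes "f abs_summable_on A" and "g abs_summable_on B"
  shows "(\<lambda>(x, y). f x * g y) abs_summable_on (A \<times> B)"
  using assms
  by (simp add: Infinite_Sum.abs_summable_on_Sigma_iff norm_mult summable_on_cmult_right infsum_cmult_right'
      summable_on_cmult_left infsum_nonneg)

text \<open>Induction on \<open>A\<close>: choosing a function on \<open>insert x A\<close> amounts
  to choosing its value at \<open>x\<close> and a function on \<open>A\<close>. The new product is
  then a product of two absolutely summable families in independent variables.\<close>

lemma abs_summable_on_prod_PiE:
  fixes f :: "'a \<Rightarrow> 'b \<Rightarrow> 'c::{real_normed_field,banach}"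
  assumes "finite A" and "\<And>x. x \<in> A \<Longrightarrow> f x abs_summable_on B x"
  shows "(\<lambda>g. \<Prod>x\<in>A. f x (g x)) abs_summable_on (PiE A B)"
  using assms
proof induction
  case empty
  then show ?case by simp
next
  case (insert x A)
  have pi: "PiE (insert x A) B = (\<lambda>(y, g). g(x := y)) ` (B x \<times> PiE A B)"
    by (simp add: PiE_insert_eq)
  have inj: "inj_on (\<lambda>(y, g). g(x := y)) (B x \<times> PiE A B)"
    using \<open>x \<notin> A\<close> by (rule inj_combinator)
  have "(\<lambda>(y, g). f x y * (\<Prod>x'\<in>A. f x' (g x'))) abs_summable_on (B x \<times> PiE A B)"
    using insert by (intro abs_summable_on_times) auto
  moreover have "(\<Prod>x'\<in>A. f x' ((g(x := y)) x')) = (\<Prod>x'\<in>A. f x' (g x'))" for g y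
    using \<open>x \<notin> A\<close> by (intro prod.cong) auto
  ultimately show ?case
    using insert.hyps
    unfolding pi summable_on_reindex[OF inj] by (simp add: o_def case_prod_unfold)
qed

text \<open>A power of a series is a product of copies of it indexed by \<open>I\<close> (or
  \<open>J\<close>), and expanding that product gives a sum over all functions on the index set.
  Joint absolute summability then merges the two resulting sums into one.\<close>

lemma power_infsum_mult_power_infsum:
  fixes f :: "'a \<Rightarrow> 'c::{real_normed_field,banach}" and g :: "'b \<Rightarrow> 'c"
  assumes f: "f abs_summable_on A" and g: "g abs_summable_on B" and "finite I" "finite J"
  shows "infsum f A ^ card I * infsum g B ^ card J =
           (\<Sum>\<^sub>\<infinity>(r, s) \<in> (I \<rightarrow>\<^sub>E A) \<times> (J \<rightarrow>\<^sub>E B). (\<Prod>j\<in>I. f (r j)) * (\<Prod>j\<in>J. g (s j)))" (is ?eq)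
    and "(\<lambda>(r, s). (\<Prod>j\<in>I. f (r j)) * (\<Prod>j\<in>J. g (s j)))
           abs_summable_on (I \<rightarrow>\<^sub>E A) \<times> (J \<rightarrow>\<^sub>E B)" (is ?summ)
proof -
  show summ: ?summ
    by (intro abs_summable_on_times abs_summable_on_prod_PiE assms)
  have "infsum f A ^ card I = (\<Sum>\<^sub>\<infinity>r\<in>I \<rightarrow>\<^sub>E A. \<Prod>j\<in>I. f (r j))"
    using infsum_prod_PiE_abs[of I "\<lambda>_. f" "\<lambda>_. A"] assms by simp
  moreover have "infsum g B ^ card J = (\<Sum>\<^sub>\<infinity>s\<in>J \<rightarrow>\<^sub>E B. \<Prod>j\<in>J. g (s j))"
    using infsum_prod_PiE_abs[of J "\<lambda>_. g" "\<lambda>_. B"] assms by simp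
  moreover have "(\<Sum>\<^sub>\<infinity>(r, s) \<in> (I \<rightarrow>\<^sub>E A) \<times> (J \<rightarrow>\<^sub>E B). (\<Prod>j\<in>I. f (r j)) * (\<Prod>j\<in>J. g (s j))) =
      (\<Sum>\<^sub>\<infinity>r\<in>I \<rightarrow>\<^sub>E A. \<Sum>\<^sub>\<infinity>s\<in>J \<rightarrow>\<^sub>E B. (\<Prod>j\<in>I. f (r j)) * (\<Prod>j\<in>J. g (s j)))"
    using abs_summable_summable[OF summ] by (intro infsum_Sigma'_banach[symmetric])
  ultimately show ?eq
    by (simp add: infsum_cmult_left' infsum_cmult_right')
qed

lemma infsum_sum:
  fixes f :: "'i \<Rightarrow> 'a \<Rightarrow> 'b::{topological_comm_monoid_add,t2_space}"
  assumes "finite I" and "\<And>i. i \<in> I \<Longrightarrow> f i summable_on A"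
  shows "(\<Sum>\<^sub>\<infinity>x\<in>A. \<Sum>i\<in>I. f i x) = (\<Sum>i\<in>I. infsum (f i) A)"
proof -
  have "((\<lambda>x. \<Sum>i\<in>I. f i x) has_sum (\<Sum>i\<in>I. infsum (f i) A)) A"
    using assms by induction (auto intro!: has_sum_add)
  then show ?thesis by (rule infsumI)
qed

section \<open>Theta series\<close>

lemma nome_pow_add: "nome_pow \<tau> (\<alpha> + \<beta>) = nome_pow \<tau> \<alpha> * nome_pow \<tau> \<beta>"
  by (simp add: nome_pow_def exp_add[symmetric] algebra_simps)

lemma nome_pow_0 [simp]: "nome_pow \<tau> 0 = 1"
  by (simp add: nome_pow_def)

lemma nome_pow_of_nat_mult: "nome_pow (of_nat N * \<tau>) \<alpha> = nome_pow \<tau> (real N * \<alpha>)"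
  by (simp add: nome_pow_def algebra_simps)

text \<open>The majorant for all theta series below. Each half of the integers gives a geometric
  series with ratio \<open>exp (-1)\<close>; the two halves share only 0.\<close>

lemma summable_on_exp_neg_abs_int: "(\<lambda>n::int. exp (- \<bar>of_int n\<bar> :: real)) summable_on UNIV"
proof -
  have "(\<lambda>n::nat. exp (- real n)) summable_on UNIV"
  proof -
    have "summable (\<lambda>n. exp (-1 :: real) ^ n)"
      by (rule summable_geometric) simp
    then show ?thesis
      by (subst summable_on_UNIV_nonneg_real_iff) (simp_all flip: exp_of_nat_mult)
  qed
  then have "(\<lambda>n::int. exp (- \<bar>of_int n\<bar> :: real)) summable_on range int"
    and "(\<lambda>n::int. exp (- \<bar>of_int n\<bar> :: real)) summable_on range (\<lambda>n. - int n)"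
    by (subst summable_on_reindex; simp add: inj_on_def o_def)+
  then have "(\<lambda>n::int. exp (- \<bar>of_int n\<bar> :: real)) summable_on range int \<union> range (\<lambda>n. - int n)"
    by (rule summable_on_union)
  moreover have "range int \<union> range (\<lambda>n. - int n) = UNIV"
    by (auto intro: int_cases2)
  ultimately show ?thesis by simp
qed

text \<open>The quadratic decay with rate pi * Im \<tau> > 0 beats every linear term in
  \<open>n\<close>; completing the square makes this explicit and leaves a factor exp(-|n|).\<close>

lemma abs_summable_theta2:
  assumes "Im \<tau> > 0"
  shows "(\<lambda>n::int. nome_pow \<tau> (of_int (n * (n + 1))) * exp (of_int (2 * n + 1) * \<i> * z))
           abs_summable_on UNIV"
proof -
  define p where "p = pi * Im \<tau>"
  \<comment> \<open>\<open>B\<close> collects the coefficients of |N|: \<open>p\<close> from the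
    linear part of N(N + 1), twice |Im z| from the exponential, and 1 to leave room for the decay
    exp(-|N|). In \<open>K\<close>, the quotient B^2/(4p) is the maximum of B t - p t^2 over real t,
    and |Im z| bounds the term free of N.\<close>
  define B where "B = p + 2 * \<bar>Im z\<bar> + 1"
  define K where "K = B\<^sup>2 / (4 * p) + \<bar>Im z\<bar>"
  have p: "p > 0" using assms by (simp add: p_def)
  show ?thesis
  proof (rule Infinite_Sum.abs_summable_on_comparison_test')
    show "(\<lambda>n::int. exp K * exp (- \<bar>of_int n\<bar> :: real)) summable_on UNIV"
      by (intro summable_on_cmult_right summable_on_exp_neg_abs_int)
    fix n :: int
    define N where "N = (of_int n :: real)"
    have "norm (nome_pow \<tau> (of_int (n * (n + 1))) * exp (of_int (2 * n + 1) * \<i> * z)) =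
        exp (- (p * N * (N + 1)) - (2 * N + 1) * Im z)"
      by (simp add: norm_mult nome_pow_def p_def N_def exp_add[symmetric] algebra_simps)
    also have "- (p * N * (N + 1)) - (2 * N + 1) * Im z \<le> K - \<bar>N\<bar>"
    proof -
      have "p * N\<^sup>2 - B * \<bar>N\<bar> + B\<^sup>2 / (4 * p) = (2 * p * \<bar>N\<bar> - B)\<^sup>2 / (4 * p)"
        using p by (simp add: field_simps power2_eq_square)
      also have "\<dots> \<ge> 0" using p by simp
      finally have "p * N\<^sup>2 - B * \<bar>N\<bar> + B\<^sup>2 / (4 * p) \<ge> 0" .
      moreover have "- (p * N) \<le> p * \<bar>N\<bar>" using p by (simp add: abs_if)
      moreover have "- (N * Im z) \<le> \<bar>N\<bar> * \<bar>Im z\<bar>"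
        by (metis abs_ge_minus_self abs_mult)
      moreover have "- Im z \<le> \<bar>Im z\<bar>" by simp
      ultimately show ?thesis
        by (simp add: K_def B_def algebra_simps power2_eq_square)
    qed
    finally show "norm (nome_pow \<tau> (of_int (n * (n + 1))) * exp (of_int (2 * n + 1) * \<i> * z))
        \<le> exp K * exp (- \<bar>of_int n\<bar>)"
      by (simp add: N_def exp_diff exp_minus field_simps)
  qed
qed

lemma abs_summable_theta1:
  assumes "Im \<tau> > 0"
  shows "(\<lambda>n::int. (-1) powi n * nome_pow \<tau> (of_int (n * (n + 1))) * exp (of_int (2 * n + 1) * \<i> * z))
           abs_summable_on UNIV"
  using abs_summable_theta2[OF assms, of z] by (simp add: norm_mult norm_power_int)

section \<open>Finite products of theta terms\<close>

text \<open>Exponents add, and r(r + 1) = r^2 + r separates the quadratic form from the index sum.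
  These two quantities are all that the product retains of the vector \<open>r\<close>.\<close>

lemma prod_theta2_terms:
  assumes "finite I"
  shows "(\<Prod>j\<in>I. nome_pow \<tau> (of_int (r j * (r j + 1))) * exp (of_int (2 * r j + 1) * \<i> * z)) =
           nome_pow \<tau> (of_int ((\<Sum>j\<in>I. (r j)\<^sup>2) + (\<Sum>j\<in>I. r j))) *
           exp (of_int (2 * (\<Sum>j\<in>I. r j) + int (card I)) * \<i> * z)"
  using assms
proof induction
  case empty
  then show ?case by simp
next
  case (insert i I)
  have "nome_pow \<tau> (of_int ((\<Sum>j\<in>insert i I. (r j)\<^sup>2) + (\<Sum>j\<in>insert i I. r j))) =
      nome_pow \<tau> (of_int (r i * (r i + 1))) *
      nome_pow \<tau> (of_int ((\<Sum>j\<in>I. (r j)\<^sup>2) + (\<Sum>j\<in>I. r j)))"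
    unfolding nome_pow_add[symmetric] using insert.hyps
    by (intro arg_cong[of _ _ "nome_pow \<tau>"]) (simp add: power2_eq_square algebra_simps)
  moreover have "exp (of_int (2 * (\<Sum>j\<in>insert i I. r j) + int (card (insert i I))) * \<i> * z) =
      exp (of_int (2 * r i + 1) * \<i> * z) * exp (of_int (2 * (\<Sum>j\<in>I. r j) + int (card I)) * \<i> * z)"
    unfolding exp_add[symmetric] using insert.hyps
    by (intro arg_cong[of _ _ exp]) (simp add: algebra_simps)
  ultimately show ?case
    using insert by simp
qed

lemma prod_powi_eq_powi_sum:
  fixes c :: "'a::field"
  assumes "finite I" and "c \<noteq> 0"
  shows "(\<Prod>j\<in>I. c powi r j) = c powi (\<Sum>j\<in>I. r j)"
  using assms by induction (auto simp: power_int_add)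

lemma prod_theta1_terms:
  assumes "finite I"
  shows "(\<Prod>j\<in>I. (-1) powi r j * nome_pow \<tau> (of_int (r j * (r j + 1))) *
              exp (of_int (2 * r j + 1) * \<i> * z)) =
           (-1) powi (\<Sum>j\<in>I. r j) *
           nome_pow \<tau> (of_int ((\<Sum>j\<in>I. (r j)\<^sup>2) + (\<Sum>j\<in>I. r j))) *
           exp (of_int (2 * (\<Sum>j\<in>I. r j) + int (card I)) * \<i> * z)"
proof -
  have "(\<Prod>j\<in>I. (-1) powi r j * nome_pow \<tau> (of_int (r j * (r j + 1))) *
              exp (of_int (2 * r j + 1) * \<i> * z)) =
      (\<Prod>j\<in>I. (-1) powi r j) *
      (\<Prod>j\<in>I. nome_pow \<tau> (of_int (r j * (r j + 1))) * exp (of_int (2 * r j + 1) * \<i> * z))"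
    by (simp only: mult.assoc prod.distrib)
  also have "(\<Prod>j\<in>I. (-1 :: complex) powi r j) = (-1) powi (\<Sum>j\<in>I. r j)"
    using assms by (rule prod_powi_eq_powi_sum) simp
  finally show ?thesis
    unfolding prod_theta2_terms[OF assms] by (simp only: mult.assoc)
qed

lemma nome_pow_quarter_power: "nome_pow \<tau> (1/4) ^ a = nome_pow \<tau> (real a / 4)"
  by (simp add: nome_pow_def mult_ac flip: exp_of_nat_mult)

section \<open>Sums of roots of unity\<close>

text \<open>The summands are the powers of \<zeta> = exp(2 pi i c / N), which satisfies \<zeta>^N =
  1. The geometric sum therefore vanishes unless \<zeta> = 1, that is, unless N divides c.\<close>

lemma sum_exp_equidistant:
  fixes c :: int
  assumes "N > 0"
  shows "(\<Sum>k<N. exp (of_int (2 * c) * \<i> * of_real (real k * pi / real N))) =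
           (if int N dvd c then of_nat N else 0)"
proof -
  define \<zeta> where "\<zeta> = exp (of_int (2 * c) * \<i> * of_real (pi / real N))"
  have pow: "exp (of_int (2 * c) * \<i> * of_real (real k * pi / real N)) = \<zeta> ^ k" for k
    by (simp add: \<zeta>_def mult_ac flip: exp_of_nat_mult)
  have "\<zeta> ^ N = exp (2 * of_int c * of_real pi * \<i>)"
    using assms by (simp add: \<zeta>_def mult_ac flip: exp_of_nat_mult)
  also have "\<dots> = 1" by (auto simp: exp_eq_1)
  finally have \<zeta>N: "\<zeta> ^ N = 1" .
  have "\<zeta> = 1 \<longleftrightarrow> (\<exists>l::int. 2 * of_int c * (pi / real N) = of_int (2 * l) * pi)"
    by (simp add: \<zeta>_def exp_eq_1)
  also have "\<dots> \<longleftrightarrow> (\<exists>l::int. real_of_int c = real_of_int (int N * l))"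
    using assms by (simp add: field_simps)
  also have "\<dots> \<longleftrightarrow> int N dvd c"
    unfolding of_int_eq_iff by (auto simp: dvd_def)
  finally have "\<zeta> = 1 \<longleftrightarrow> int N dvd c" .
  then show ?thesis
    unfolding pow using \<zeta>N by (auto simp: geometric_sum)
qed

section \<open>Expansion of the product of powers into one series\<close>

text \<open>General term of the expanded product of powers, with all constants absorbed:
  \<open>(- \<i>) ^ a\<close> comes from the factors \<open>theta1\<close>, and
  \<open>real (a + b) / 4\<close> gathers the quarter powers of the nome.\<close>

definition theta_product_term ::
  "nat \<Rightarrow> nat \<Rightarrow> complex \<Rightarrow> complex \<Rightarrow> complex \<Rightarrow> (nat \<Rightarrow> int) \<times> (nat \<Rightarrow> int) \<Rightarrow> complex" where
  "theta_product_term a b \<tau> v w = (\<lambda>(r, s).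
     let A = (\<Sum>j=1..a. r j); B = (\<Sum>j=1..b. s j);
         Q = (\<Sum>j=1..a. (r j)\<^sup>2) + (\<Sum>j=1..b. (s j)\<^sup>2)
     in (- \<i>) ^ a * (-1) powi A * nome_pow \<tau> (of_int (Q + A + B) + real (a + b) / 4) *
        exp (\<i> * (of_int (2 * A + int a) * v + of_int (2 * B + int b) * w)))"

text \<open>Summability is recorded along with the value: it justifies both exchanging the series
  with the finite sum over translates and regrouping it along the shift bijection.\<close>

lemma theta1_power_mult_theta2_power:
  fixes a b :: nat
  assumes "Im \<tau> > 0"
  defines "X \<equiv> ({1..a} \<rightarrow>\<^sub>E UNIV) \<times> ({1..b} \<rightarrow>\<^sub>E UNIV)"
  shows "theta1 v \<tau> ^ a * theta2 w \<tau> ^ b = infsum (theta_product_term a b \<tau> v w) X" (is ?eq)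
    and "theta_product_term a b \<tau> v w summable_on X" (is ?summ)
proof -
  define f where "f = (\<lambda>n::int. (-1) powi n * nome_pow \<tau> (of_int (n * (n + 1))) *
                        exp (of_int (2 * n + 1) * \<i> * v))"
  define g where "g = (\<lambda>n::int. nome_pow \<tau> (of_int (n * (n + 1))) *
                        exp (of_int (2 * n + 1) * \<i> * w))"
  define C where "C = (- \<i>) ^ a * nome_pow \<tau> (real a / 4) * nome_pow \<tau> (real b / 4)"
  have f: "f abs_summable_on UNIV" and g: "g abs_summable_on UNIV"
    unfolding f_def g_def by (rule abs_summable_theta1 abs_summable_theta2, fact)+
  note prods = power_infsum_mult_power_infsum[OF f g finite_atLeastAtMost[of 1 a]
      finite_atLeastAtMost[of 1 b], folded X_def]
  have summ: "(\<lambda>(r, s). (\<Prod>j=1..a. f (r j)) * (\<Prod>j=1..b. g (s j))) summable_on X"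
    using prods(2) by (rule abs_summable_summable)
  have term_eq: "theta_product_term a b \<tau> v w =
      (\<lambda>p. C * (case p of (r, s) \<Rightarrow> (\<Prod>j=1..a. f (r j)) * (\<Prod>j=1..b. g (s j))))"
  proof (intro ext, clarify)
    fix r s :: "nat \<Rightarrow> int"
    define A where "A = (\<Sum>j=1..a. r j)"
    define B where "B = (\<Sum>j=1..b. s j)"
    define A2 where "A2 = (\<Sum>j=1..a. (r j)\<^sup>2)"
    define B2 where "B2 = (\<Sum>j=1..b. (s j)\<^sup>2)"
    have "real_of_int (A2 + B2 + A + B) + real (a + b) / 4 =
        of_int (A2 + A) + (of_int (B2 + B) + (real a / 4 + real b / 4))"
      by (simp add: add_divide_distrib)
    then have nome: "nome_pow \<tau> (of_int (A2 + B2 + A + B) + real (a + b) / 4) =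
        nome_pow \<tau> (of_int (A2 + A)) * (nome_pow \<tau> (of_int (B2 + B)) *
          (nome_pow \<tau> (real a / 4) * nome_pow \<tau> (real b / 4)))"
      by (simp only: nome_pow_add)
    have expo: "exp (\<i> * (of_int (2 * A + int a) * v + of_int (2 * B + int b) * w)) =
        exp (of_int (2 * A + int a) * \<i> * v) * exp (of_int (2 * B + int b) * \<i> * w)"
      unfolding exp_add[symmetric] by (simp add: algebra_simps)
    show "theta_product_term a b \<tau> v w (r, s) =
        C * ((\<Prod>j=1..a. f (r j)) * (\<Prod>j=1..b. g (s j)))"
      unfolding theta_product_term_def Let_def prod.case f_def g_def C_def
        prod_theta1_terms[OF finite_atLeastAtMost] prod_theta2_terms[OF finite_atLeastAtMost]
        A_def[symmetric] B_def[symmetric] A2_def[symmetric] B2_def[symmetric] nome expo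
      by (simp only: card_atLeastAtMost diff_Suc_1 mult_ac)
  qed
  show ?summ
    unfolding term_eq by (intro summable_on_cmult_right summ)
  have "theta1 v \<tau> = - \<i> * nome_pow \<tau> (1/4) * infsum f UNIV"
    and "theta2 w \<tau> = nome_pow \<tau> (1/4) * infsum g UNIV"
    by (simp_all add: theta1_def theta2_def f_def g_def)
  then have "theta1 v \<tau> ^ a * theta2 w \<tau> ^ b = C * (infsum f UNIV ^ a * infsum g UNIV ^ b)"
    by (simp only: power_mult_distrib nome_pow_quarter_power C_def mult_ac)
  also have "\<dots> = C * (\<Sum>\<^sub>\<infinity>(r, s)\<in>X. (\<Prod>j=1..a. f (r j)) * (\<Prod>j=1..b. g (s j)))"
    using prods(1) by simp
  also have "\<dots> = infsum (theta_product_term a b \<tau> v w) X"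
    unfolding term_eq by (rule infsum_cmult_right'[symmetric])
  finally show ?eq .
qed

text \<open>Both arguments move by the same \<open>u\<close>, so the coefficients 2A + a and 2B + b
  of \<open>u\<close> add up and only the total index sum matters.\<close>

lemma theta_product_term_translate:
  "theta_product_term a b \<tau> (v + u) (w + u) (r, s) = theta_product_term a b \<tau> v w (r, s) *
     exp (of_int (2 * ((\<Sum>j=1..a. r j) + (\<Sum>j=1..b. s j)) + int (a + b)) * \<i> * u)"
  by (simp add: theta_product_term_def Let_def algebra_simps flip: exp_add)

section \<open>Translation of the index vectors\<close>

text \<open>The restriction keeps shifted vectors \<open>undefined\<close> outside the index ranges,
  so that the shift maps the extensional function space to itself and opposite shifts are inverse
  there.\<close>

definition shift_indices ::
  "nat \<Rightarrow> nat \<Rightarrow> int \<Rightarrow> (nat \<Rightarrow> int) \<times> (nat \<Rightarrow> int) \<Rightarrow> (nat \<Rightarrow> int) \<times> (nat \<Rightarrow> int)" where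
  "shift_indices a b d = (\<lambda>(r, s). (\<lambda>j\<in>{1..a}. r j + d, \<lambda>j\<in>{1..b}. s j + d))"

lemma shift_indices_shift_indices:
  assumes "p \<in> ({1..a} \<rightarrow>\<^sub>E UNIV) \<times> ({1..b} \<rightarrow>\<^sub>E UNIV)" and "d + e = 0"
  shows "shift_indices a b d (shift_indices a b e p) = p"
  using assms
  by (auto simp: shift_indices_def fun_eq_iff restrict_def PiE_def extensional_def)

text \<open>On \<open>R12_indices\<close> the index sum is fixed, so the cross term of the shifted quadratic form is
  constant and the Gaussian factor splits into a function of \<open>d\<close> times a function of \<open>p\<close>.\<close>

lemma theta_product_term_shift_indices:
  assumes "p \<in> R12_indices a b (a + b)" and "of_nat a * x + of_nat b * y = 0"
  shows "theta_product_term a b \<tau> (z + x) (z + y) (shift_indices a b d p) =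
    (- \<i>) ^ a * nome_pow \<tau> (- (real (a + b) / 4)) *
    ((-1) powi (int a * d) * nome_pow \<tau> (real (a + b) * of_int (d\<^sup>2)) *
     exp (2 * of_int d * \<i> * (of_nat (a + b) * z))) *
    (case p of (r, s) \<Rightarrow>
        (-1) powi (\<Sum>j=1..a. r j) *
        nome_pow \<tau> (of_int ((\<Sum>j=1..a. (r j)\<^sup>2) + (\<Sum>j=1..b. (s j)\<^sup>2))) *
        exp (2 * \<i> * (of_int (\<Sum>j=1..a. r j) * x + of_int (\<Sum>j=1..b. s j) * y)))"
proof -
  obtain r s where p: "p = (r, s)" by fastforce
  define A where "A = (\<Sum>j=1..a. r j)"
  define B where "B = (\<Sum>j=1..b. s j)"
  define Q where "Q = (\<Sum>j=1..a. (r j)\<^sup>2) + (\<Sum>j=1..b. (s j)\<^sup>2)"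
  have AB: "2 * (A + B) + int (a + b) = 0"
    using assms(1) by (simp add: p R12_indices_def A_def B_def)
  have A': "(\<Sum>j=1..a. (\<lambda>j\<in>{1..a}. r j + d) j) = A + int a * d"
    and B': "(\<Sum>j=1..b. (\<lambda>j\<in>{1..b}. s j + d) j) = B + int b * d"
    by (simp_all add: A_def B_def sum.distrib)
  have Q': "(\<Sum>j=1..a. ((\<lambda>j\<in>{1..a}. r j + d) j)\<^sup>2) + (\<Sum>j=1..b. ((\<lambda>j\<in>{1..b}. s j + d) j)\<^sup>2) =
      Q + 2 * d * (A + B) + int (a + b) * d\<^sup>2"
    by (simp add: Q_def A_def B_def power2_sum sum.distrib sum_distrib_left sum_distrib_right
        algebra_simps)
  have "real_of_int (2 * (A + B) + int (a + b)) = 0"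
    unfolding AB by simp
  then have nAB: "real (a + b) = - 2 * real_of_int (A + B)" by simp
  have "real_of_int (Q + 2 * d * (A + B) + int (a + b) * d\<^sup>2 + (A + int a * d) + (B + int b * d)) +
      real (a + b) / 4 =
      of_int Q + 2 * of_int d * of_int (A + B) + real (a + b) * of_int (d\<^sup>2) + of_int (A + B) +
      real (a + b) * of_int d + real (a + b) / 4"
    by (simp add: algebra_simps)
  \<comment> \<open>Put n = a + b, so that A + B = -n/2. The cross term 2d(A + B) cancels nd, and A
    + B + n/4 becomes -n/4, the exponent in front of the series in \<open>R12\<close>.\<close>
  also have "\<dots> = - (real (a + b) / 4) + (real (a + b) * of_int (d\<^sup>2) + of_int Q)"
    unfolding nAB by (simp add: algebra_simps)
  finally have nome: "nome_pow \<tau> (of_int (Q + 2 * d * (A + B) + int (a + b) * d\<^sup>2 +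
          (A + int a * d) + (B + int b * d)) + real (a + b) / 4) =
      nome_pow \<tau> (- (real (a + b) / 4)) * (nome_pow \<tau> (real (a + b) * of_int (d\<^sup>2)) *
        nome_pow \<tau> (of_int Q))"
    by (simp only: nome_pow_add)
  have "complex_of_int (2 * (A + B) + int (a + b)) = 0"
    unfolding AB by simp
  then have cAB: "2 * (of_int A + of_int B) + (of_nat a + of_nat b) = (0 :: complex)" by simp
  \<comment> \<open>The terms are grouped so that the last two vanish: one by the index condition on
    \<open>R12_indices\<close>, the other by the relation between \<open>x\<close> and
    \<open>y\<close>.\<close>
  have "of_int (2 * (A + int a * d) + int a) * (z + x) + of_int (2 * (B + int b * d) + int b) * (z + y) =
      2 * of_int d * (of_nat (a + b) * z) + 2 * (of_int A * x + of_int B * y) +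
      (2 * (of_int A + of_int B) + (of_nat a + of_nat b)) * z +
      (2 * of_int d + 1) * (of_nat a * x + of_nat b * y)"
    by (simp add: algebra_simps)
  then have arg: "of_int (2 * (A + int a * d) + int a) * (z + x) +
        of_int (2 * (B + int b * d) + int b) * (z + y) =
      2 * of_int d * (of_nat (a + b) * z) + 2 * (of_int A * x + of_int B * y)"
    unfolding cAB assms(2) by simp
  have expo: "exp (\<i> * (of_int (2 * (A + int a * d) + int a) * (z + x) +
        of_int (2 * (B + int b * d) + int b) * (z + y))) =
      exp (2 * of_int d * \<i> * (of_nat (a + b) * z)) * exp (2 * \<i> * (of_int A * x + of_int B * y))"
    unfolding arg exp_add[symmetric] by (simp add: algebra_simps)
  show ?thesis
    unfolding p shift_indices_def theta_product_term_def Let_def prod.case A' B' Q' nome expo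
      A_def[symmetric] B_def[symmetric] Q_def[symmetric]
    by (simp add: power_int_add mult_ac)
qed

text \<open>A shift by ml raises the index sum by mnl, as there are n indices. Hence every vector
  whose offset index sum is a multiple of mn comes, for exactly one l, from a vector with offset sum
  0.\<close>

lemma bij_betw_shift_indices:
  assumes "m > 0" and "n > 0" and "a + b = n" and "n = 2 * h"
  shows "bij_betw (\<lambda>(l, p). shift_indices a b (int m * l) p) (UNIV \<times> R12_indices a b n)
    {(r, s) \<in> ({1..a} \<rightarrow>\<^sub>E UNIV) \<times> ({1..b} \<rightarrow>\<^sub>E UNIV).
       int (m * n) dvd (\<Sum>j=1..a. r j) + (\<Sum>j=1..b. s j) + int h}"
    (is "bij_betw ?f ?P ?Y")
proof -
  \<comment> \<open>With n = 2h, the condition 2N + n = 0 of \<open>R12_indices\<close> on the index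
    sum N reads N + h = 0, so it becomes \<open>D p = 0\<close>.\<close>
  define D where "D = (\<lambda>(r, s). (\<Sum>j=1..a. r j) + (\<Sum>j=1..b. s j) + int h)"
  define X :: "((nat \<Rightarrow> int) \<times> (nat \<Rightarrow> int)) set"
    where "X = ({1..a} \<rightarrow>\<^sub>E UNIV) \<times> ({1..b} \<rightarrow>\<^sub>E UNIV)"
  have Y: "?Y = {p \<in> X. int (m * n) dvd D p}"
    by (auto simp: X_def D_def)
  have R: "R12_indices a b n = {p \<in> X. D p = 0}"
    using assms by (auto simp: X_def D_def R12_indices_def)
  have X: "shift_indices a b d p \<in> X" for d p
    by (auto simp: shift_indices_def X_def split: prod.splits)
  have D: "D (shift_indices a b d p) = D p + int n * d" for d p
    unfolding \<open>a + b = n\<close>[symmetric]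
    by (auto simp: shift_indices_def D_def sum.distrib algebra_simps split: prod.splits)
  have inv: "shift_indices a b d (shift_indices a b e p) = p" if "p \<in> X" "d + e = 0" for d e p
    using shift_indices_shift_indices that unfolding X_def by blast
  \<comment> \<open>The inverse reads l off from D p = mnl by division and undoes the shift by
    ml.\<close>
  define g where "g = (\<lambda>p. (D p div int (m * n), shift_indices a b (- (int m * (D p div int (m * n)))) p))"
  show ?thesis
    unfolding Y R
  proof (rule bij_betw_byWitness[where f' = g])
    show "\<forall>q\<in>UNIV \<times> {p \<in> X. D p = 0}. g (?f q) = q"
      using assms by (auto simp: g_def D inv)
    show "\<forall>p\<in>{p \<in> X. int (m * n) dvd D p}. ?f (g p) = p"
      by (auto simp: g_def inv)
    show "?f ` (UNIV \<times> {p \<in> X. D p = 0}) \<subseteq> {p \<in> X. int (m * n) dvd D p}"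
      by (auto simp: X D)
    show "g ` {p \<in> X. int (m * n) dvd D p} \<subseteq> UNIV \<times> {p \<in> X. D p = 0}"
      by (auto simp: g_def X D)
  qed
qed

section \<open>Summation over the translates\<close>

text \<open>Keeping the sign as a power of -1 with exponent mal treats both parities of ma at
  once.\<close>

lemma theta_sum_eq_R12_mult_theta_series:
  assumes \<tau>: "Im \<tau> > 0" and "even n" and "n > 0" and "m > 0" and ab: "a + b = n"
    and xy: "of_nat a * x + of_nat b * y = 0"
  shows "theta_sum a b x y m n \<tau> z = R12 a b x y m n \<tau> *
    (\<Sum>\<^sub>\<infinity>l::int. (-1) powi (int (m * a) * l) * nome_pow (of_nat (m\<^sup>2 * n) * \<tau>) (of_int (l\<^sup>2)) *
       exp (2 * of_int l * \<i> * (of_nat (m * n) * z)))"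
proof -
  obtain h where h: "n = 2 * h" using \<open>even n\<close> by blast
  have mn: "m * n > 0" using assms by simp
  define X :: "((nat \<Rightarrow> int) \<times> (nat \<Rightarrow> int)) set"
    where "X = ({1..a} \<rightarrow>\<^sub>E UNIV) \<times> ({1..b} \<rightarrow>\<^sub>E UNIV)"
  define u where "u k = complex_of_real (real k * pi / real (m * n))" for k
  define D where "D = (\<lambda>(r, s). (\<Sum>j=1..a. r j) + (\<Sum>j=1..b. s j) + int h)"
  define Y where "Y = {(r, s) \<in> X. int (m * n) dvd (\<Sum>j=1..a. r j) + (\<Sum>j=1..b. s j) + int h}"
  define T where "T = theta_product_term a b \<tau> (z + x) (z + y)"
  define K where "K = (\<lambda>l::int. (-1) powi (int (m * a) * l) *
      nome_pow (of_nat (m\<^sup>2 * n) * \<tau>) (of_int (l\<^sup>2)) * exp (2 * of_int l * \<i> * (of_nat (m * n) * z)))"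
  define H where "H = (\<lambda>(r, s).
      (-1) powi (\<Sum>j=1..a. r j) *
      nome_pow \<tau> (of_int ((\<Sum>j=1..a. (r j)\<^sup>2) + (\<Sum>j=1..b. (s j)\<^sup>2))) *
      exp (2 * \<i> * (of_int (\<Sum>j=1..a. r j) * x + of_int (\<Sum>j=1..b. s j) * y)))"
  define c where "c = (- \<i>) ^ a * nome_pow \<tau> (- (real n / 4))"
  note expand = theta1_power_mult_theta2_power[OF \<tau>, where a = a and b = b, folded X_def]
  \<comment> \<open>Evenness of n enters here: 2N + n = 2(N + h) has the form \<open>2 * c\<close>
    required by \<open>sum_exp_equidistant\<close>.\<close>
  have trans: "theta_product_term a b \<tau> (z + x + u k) (z + y + u k) p =
      T p * exp (of_int (2 * D p) * \<i> * u k)" for k p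
  proof -
    obtain r s where p: "p = (r, s)" by fastforce
    have "2 * ((\<Sum>j=1..a. r j) + (\<Sum>j=1..b. s j)) + int (a + b) = 2 * D p"
      using ab h by (simp add: p D_def)
    then show ?thesis
      unfolding p theta_product_term_translate T_def by (simp only:)
  qed
  have "theta_sum a b x y m n \<tau> z =
      (\<Sum>k<m * n. infsum (theta_product_term a b \<tau> (z + x + u k) (z + y + u k)) X)"
    by (simp only: theta_sum_def u_def expand(1))
  also have "\<dots> = (\<Sum>\<^sub>\<infinity>p\<in>X. \<Sum>k<m * n. theta_product_term a b \<tau> (z + x + u k) (z + y + u k) p)"
    by (intro infsum_sum[symmetric] finite_lessThan expand(2))
  also have "\<dots> = (\<Sum>\<^sub>\<infinity>p\<in>X. T p * (if int (m * n) dvd D p then of_nat (m * n) else 0))"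
    unfolding trans sum_distrib_left[symmetric] unfolding u_def sum_exp_equidistant[OF mn] ..
  also have "\<dots> = (\<Sum>\<^sub>\<infinity>p\<in>Y. of_nat (m * n) * T p)"
    by (rule infsum_cong_neutral) (auto simp: Y_def D_def)
  also have "\<dots> = of_nat (m * n) * infsum T Y"
    by (rule infsum_cmult_right')
  also have "infsum T Y = c * (infsum K UNIV * infsum H (R12_indices a b n))"
  proof -
    note bij = bij_betw_shift_indices[OF \<open>m > 0\<close> \<open>n > 0\<close> ab h, folded X_def, folded Y_def]
    have T_shift: "T (case q of (l, p) \<Rightarrow> shift_indices a b (int m * l) p) =
        (case q of (l, p) \<Rightarrow> c * K l * H p)" if q: "q \<in> UNIV \<times> R12_indices a b n" for q
    proof -
      obtain l p where q_eq: "q = (l, p)" by (cases q)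
      have "p \<in> R12_indices a b (a + b)" using q ab by (simp add: q_eq)
      from theta_product_term_shift_indices[OF this xy, of \<tau> z "int m * l"]
      have "T (shift_indices a b (int m * l) p) = c *
          ((-1) powi (int a * (int m * l)) * nome_pow \<tau> (real n * of_int ((int m * l)\<^sup>2)) *
           exp (2 * of_int (int m * l) * \<i> * (of_nat n * z))) * H p"
        unfolding T_def c_def H_def ab .
      \<comment> \<open>For d = ml the exponent n d^2 becomes m^2 n l^2, which is why the series in
        l lives at m^2 n \<tau>.\<close>
      also have "(-1) powi (int a * (int m * l)) * nome_pow \<tau> (real n * of_int ((int m * l)\<^sup>2)) *
           exp (2 * of_int (int m * l) * \<i> * (of_nat n * z)) = K l"
        unfolding K_def nome_pow_of_nat_mult
        by (simp add: power_mult_distrib mult_ac)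
      finally show ?thesis by (simp add: q_eq)
    qed
    \<comment> \<open>Summability passes from \<open>X\<close> to the subset \<open>Y\<close> and
      through the bijection to the pairs (l, p), where it allows the double sum to be iterated and
      factored.\<close>
    have "T summable_on X"
      unfolding T_def by (rule expand(2))
    then have "T summable_on Y"
      by (rule summable_on_subset) (auto simp: Y_def)
    then have summ: "(\<lambda>(l, p). c * K l * H p) summable_on UNIV \<times> R12_indices a b n"
      using summable_on_reindex_bij_betw[OF bij, of T] summable_on_cong[OF T_shift, of _ "\<lambda>q. q"] by simp
    have "infsum T Y = (\<Sum>\<^sub>\<infinity>(l, p)\<in>UNIV \<times> R12_indices a b n. c * K l * H p)"
      using infsum_reindex_bij_betw[OF bij, of T] infsum_cong[OF T_shift, of _ "\<lambda>q. q"] by simp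
    also have "\<dots> = (\<Sum>\<^sub>\<infinity>l. \<Sum>\<^sub>\<infinity>p\<in>R12_indices a b n. c * K l * H p)"
      by (rule infsum_Sigma'_banach[symmetric, OF summ])
    also have "\<dots> = c * (infsum K UNIV * infsum H (R12_indices a b n))"
      by (simp add: infsum_cmult_left' infsum_cmult_right' mult.assoc)
    finally show ?thesis .
  qed
  finally show ?thesis
    by (simp add: R12_def c_def H_def K_def mult_ac)
qed

theorem theorem3p9:
  fixes \<tau> x y :: complex and m n a b :: nat
  assumes "Im \<tau> > 0"
    and "even n" and "n > 0" and "m > 0"
    and "a + b = n"
    and "of_nat a * x + of_nat b * y = 0"
  shows "\<forall>z::complex.
      (even (m * a) \<longrightarrow>
        theta_sum a b x y m n \<tau> z
          = R12 a b x y m n \<tau> * theta3 (of_nat (m * n) * z) (of_nat (m\<^sup>2 * n) * \<tau>)) \<and>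
      (odd (m * a) \<longrightarrow>
        theta_sum a b x y m n \<tau> z
          = R12 a b x y m n \<tau> * theta4 (of_nat (m * n) * z) (of_nat (m\<^sup>2 * n) * \<tau>))"
proof -
  \<comment> \<open>The sign is trivial for even ma, giving \<open>theta3\<close>, and alternates
    with l for odd ma, giving \<open>theta4\<close>.\<close>
  have sign: "(-1 :: complex) powi (int (m * a) * l) = (if even (m * a) then 1 else (-1) powi l)"
    for l :: int
    by (auto simp: power_int_minus_left)
  show ?thesis
    unfolding theta_sum_eq_R12_mult_theta_series[OF assms] sign theta3_def theta4_def
    by simp
qed

end
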